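(* Let $G$ be a simple graph, let $\mathcal{T}(G)$ be any output of the Star-Expansion algorithm applied to $G$, and let $L(\mathcal{T}(G))$ be the multiset of labels of the leaves (childless nodes) of $\mathcal{T}(G)$. Then every $H\in L(\mathcal{T}(G))$ is a disjoint union of stars and $$X_G=\sum_{H\in L(\mathcal{T}(G))}(-1)^{\iota(H)-\iota(G)}\,\mathfrak{st}_{\lambda(H)}.$$ Moreover, no cancellations occur: for every partition $\lambda$, all terms $\mathfrak{st}_\lambda$ in this sum appear with the same sign.
   Context: For a simple graph $G$ with vertices $v_1,\dots,v_n$, the chromatic symmetric function is $X_G=\sum_\kappa x_{\kappa(v_1)}\cdots x_{\kappa(v_n)}$ over all proper colorings $\kappa:V(G)\to\{1,2,\dots\}$ (adjacent vertices get different colors), $x_1,x_2,\dots$ commuting indeterminates. $St_k$ denotes the star graph on $k$ vertices (one vertex adjacent to all other $k-1$ vertices, no other edges; $St_1$ is a single vertex, $St_2$ a single edge). Set $\mathfrak{st}_k=X_{St_k}$ and, for a partition $\lambda=(\lambda_1,\dots,\lambda_l)$, $\mathfrak{st}_\lambda=\mathfrak{st}_{\lambda_1}\cdots\mathfrak{st}_{\lambda_l}$. For a graph $H$, $\iota(H)$ is the number of isolated vertices of $H$; if $H$ is a disjoint union of stars, $\lambda(H)$ is the partition whose parts are the numbers of vertices of its connected components. An edge is internal if it is not a loop and both its endpoints have degree greater than $1$. For a graph $H$, $H^s$ is obtained by deleting loops and replacing each class of parallel edges by one edge. For a non-loop edge $e=uv$ of $H$, $H\odot e$ is obtained by contracting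 $e$ (delete $e$, merge $u,v$ into a new vertex $v'$ which inherits all other edges incident with $u$ or $v$) and then adding a new vertex $v''$ and a new edge $\ell_e=v'v''$; $(H\odot e)^s\setminus \ell_e$ is $(H\odot e)^s$ with the edge $\ell_e$ deleted. The Star-Expansion algorithm on input a simple graph $G$ builds a rooted tree $\mathcal{T}$ whose nodes are labeled by simple graphs and whose edges are labeled $+$ or $-$: initially $\mathcal{T}$ is a single root labeled $G$. While some childless node labeled $H$ has an internal edge, choose such a node and such an internal edge $e$ of $H$ (arbitrarily) and attach to it three children labeled $H\setminus e$ (edge label $+$), $(H\odot e)^s$ (edge label $+$) and $(H\odot e)^s\setminus\ell_e$ (edge label $-$). The algorithm stops when no childless node has a label with an internal edge, and outputs $\mathcal{T}(G)=\mathcal{T}$. *)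

theory Defs
  imports Complex_Main "HOL-Library.Multiset" "HOL-Library.FuncSet"
begin

section \<open>Formal power series in the commuting indeterminates \<open>x\<^sub>1, x\<^sub>2, \<dots>\<close>\<close>

text \<open>A monomial is the finite multiset of the indices of its indeterminates; a power series
  is the function that sends each monomial to its coefficient. Degrees need not be bounded and
  infinitely many indeterminates may occur.\<close>

typedef 'k mps = "UNIV :: (nat multiset \<Rightarrow> 'k) set"
  morphisms mps_coeff Abs_mps by simp

setup_lifting type_definition_mps

lemma mps_eq_iff: "f = g \<longleftrightarrow> (\<forall>m. mps_coeff f m = mps_coeff g m)"
  by (metis ext mps_coeff_inject)

lemma finite_submultisets [simp]: "finite {a. a \<subseteq># (m :: 'b multiset)}"
proof (induction m)
  case empty
  then show ?case by simp
next
  case (add x m)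
  have "{a. a \<subseteq># add_mset x m} \<subseteq> {a. a \<subseteq># m} \<union> add_mset x ` {a. a \<subseteq># m}"
  proof
    fix a assume a: "a \<in> {a. a \<subseteq># add_mset x m}"
    show "a \<in> {a. a \<subseteq># m} \<union> add_mset x ` {a. a \<subseteq># m}"
    proof (cases "x \<in># a")
      case True
      then obtain b where "a = add_mset x b" by (metis insert_DiffM)
      then show ?thesis using a by auto
    next
      case False
      then have "a - {#x#} = a" by simp
      then have "a \<subseteq># m"
        using a by (metis mem_Collect_eq subset_eq_diff_conv add_mset_add_single)
      then show ?thesis by simp
    qed
  qed
  then show ?case using add.IH by (meson finite_UnI finite_imageI finite_subset)
qed

instantiation mps :: (comm_ring_1) comm_ring_1
begin

lift_definition zero_mps :: "'a mps" is "\<lambda>_. 0" .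
lift_definition one_mps :: "'a mps" is "\<lambda>m. if m = {#} then 1 else 0" .
lift_definition plus_mps :: "'a mps \<Rightarrow> 'a mps \<Rightarrow> 'a mps" is "\<lambda>f g m. f m + g m" .
lift_definition minus_mps :: "'a mps \<Rightarrow> 'a mps \<Rightarrow> 'a mps" is "\<lambda>f g m. f m - g m" .
lift_definition uminus_mps :: "'a mps \<Rightarrow> 'a mps" is "\<lambda>f m. - f m" .
lift_definition times_mps :: "'a mps \<Rightarrow> 'a mps \<Rightarrow> 'a mps"
  is "\<lambda>f g m. \<Sum>a\<in>{a. a \<subseteq># m}. f a * g (m - a)" .

instance
proof
  fix f g h :: "'a mps"
  show "f + g + h = f + (g + h)" "f + g = g + f" "0 + f = f" "- f + f = 0" "f - g = f + - g"
    by (transfer, simp add: algebra_simps)+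
  show "(0 :: 'a mps) \<noteq> 1"
    by transfer (auto simp: fun_eq_iff)
  show "(f + g) * h = f * h + g * h"
    by transfer (simp add: distrib_right sum.distrib)
  show "f * g = g * f"
  proof (transfer, rule ext)
    fix f g :: "nat multiset \<Rightarrow> 'a" and m
    show "(\<Sum>a\<in>{a. a \<subseteq># m}. f a * g (m - a)) = (\<Sum>a\<in>{a. a \<subseteq># m}. g a * f (m - a))"
      by (rule sum.reindex_bij_witness[of _ "\<lambda>a. m - a" "\<lambda>a. m - a"])
        (auto simp: subset_mset.diff_diff_right mult.commute double_diff)
  qed
  show "1 * f = f"
  proof (transfer, rule ext)
    fix f :: "nat multiset \<Rightarrow> 'a" and m
    have "(\<Sum>a\<in>{a. a \<subseteq># m}. (if a = {#} then 1 else 0) * f (m - a))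
        = (\<Sum>a\<in>{a. a \<subseteq># m}. if a = {#} then f (m - a) else 0)"
      by (rule sum.cong) auto
    then show "(\<Sum>a\<in>{a. a \<subseteq># m}. (if a = {#} then 1 else 0) * f (m - a)) = f m"
      by simp
  qed
  show "f * g * h = f * (g * h)"
  proof (transfer, rule ext)
    fix f g h :: "nat multiset \<Rightarrow> 'a" and m
    have "(\<Sum>a\<in>{a. a \<subseteq># m}. (\<Sum>b\<in>{b. b \<subseteq># a}. f b * g (a - b)) * h (m - a))
        = (\<Sum>(a, b)\<in>(SIGMA a:{a. a \<subseteq># m}. {b. b \<subseteq># a}). f b * g (a - b) * h (m - a))"
      by (simp add: sum.Sigma sum_distrib_right)
    also have "\<dots> = (\<Sum>(b, c)\<in>(SIGMA b:{b. b \<subseteq># m}. {c. c \<subseteq># m - b}).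
        f b * (g c * h (m - b - c)))"
      by (rule sum.reindex_bij_witness[of _ "\<lambda>(b, c). (b + c, b)" "\<lambda>(a, b). (b, a - b)"])
        (auto simp: subset_mset.le_iff_add mult.assoc)
    also have "\<dots> = (\<Sum>b\<in>{b. b \<subseteq># m}. f b * (\<Sum>c\<in>{c. c \<subseteq># m - b}. g c * h (m - b - c)))"
      by (simp add: sum.Sigma sum_distrib_left)
    finally show "(\<Sum>a\<in>{a. a \<subseteq># m}. (\<Sum>b\<in>{b. b \<subseteq># a}. f b * g (a - b)) * h (m - a))
        = (\<Sum>b\<in>{b. b \<subseteq># m}. f b * (\<Sum>c\<in>{c. c \<subseteq># m - b}. g c * h (m - b - c)))" .
  qed
qed

end

lift_definition mps_const :: "'k::zero \<Rightarrow> 'k mps" is "\<lambda>c m. if m = {#} then c else 0" .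

lift_definition mps_var :: "nat \<Rightarrow> 'k::zero_neq_one mps" is "\<lambda>i m. if m = {#i#} then 1 else 0" .


section \<open>Graphs\<close>

text \<open>An edge is the set of its endpoints, so a loop at \<open>v\<close> is the edge \<open>{v}\<close>. Parallel
  edges are counted by the multiplicity in the multiset of edges.\<close>

datatype 'a mgraph = MGraph (verts: "'a set") (edges: "'a set multiset")

definition simple_graph :: "'a mgraph \<Rightarrow> bool" where
  "simple_graph G \<longleftrightarrow> finite (verts G) \<and>
     (\<forall>e\<in>#edges G. e \<subseteq> verts G \<and> card e = 2 \<and> count (edges G) e = 1)"

definition adjacent :: "'a mgraph \<Rightarrow> 'a \<Rightarrow> 'a \<Rightarrow> bool" where
  "adjacent G u v \<longleftrightarrow> {u, v} \<in># edges G"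

text \<open>A loop contributes two to the degree.\<close>

definition vertex_degree :: "'a mgraph \<Rightarrow> 'a \<Rightarrow> nat" where
  "vertex_degree G v = size {#e \<in># edges G. v \<in> e#} + count (edges G) {v}"

definition isolated_count :: "'a mgraph \<Rightarrow> nat" where
  "isolated_count G = card {v \<in> verts G. vertex_degree G v = 0}"

definition internal_edge :: "'a mgraph \<Rightarrow> 'a set \<Rightarrow> bool" where
  "internal_edge G e \<longleftrightarrow> e \<in># edges G \<and> card e = 2 \<and> (\<forall>v\<in>e. vertex_degree G v > 1)"

definition graph_iso :: "'a mgraph \<Rightarrow> 'b mgraph \<Rightarrow> bool" where
  "graph_iso G H \<longleftrightarrow> (\<exists>f. bij_betw f (verts G) (verts H) \<and> image_mset (image f) (edges G) = edges H)"

definition induced_subgraph :: "'a mgraph \<Rightarrow> 'a set \<Rightarrow> 'a mgraph" where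
  "induced_subgraph G C = MGraph C {#e \<in># edges G. e \<subseteq> C#}"

definition components :: "'a mgraph \<Rightarrow> 'a set set" where
  "components G = {{w \<in> verts G. (adjacent G)\<^sup>*\<^sup>* v w} | v. v \<in> verts G}"

definition star_graph :: "nat \<Rightarrow> nat mgraph" where
  "star_graph k = MGraph {..<k} (mset_set ((\<lambda>i. {0, i}) ` {1..<k}))"

definition disjoint_union_of_stars :: "'a mgraph \<Rightarrow> bool" where
  "disjoint_union_of_stars G \<longleftrightarrow>
     (\<forall>C\<in>components G. \<exists>k\<ge>1. graph_iso (induced_subgraph G C) (star_graph k))"

text \<open>Integer partitions are multisets of positive integers.\<close>

definition component_partition :: "'a mgraph \<Rightarrow> nat multiset" where
  "component_partition G = image_mset card (mset_set (components G))"


section \<open>Chromatic symmetric functions\<close>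

definition proper_colorings :: "'a mgraph \<Rightarrow> ('a \<Rightarrow> nat) set" where
  "proper_colorings G = {\<kappa> \<in> verts G \<rightarrow>\<^sub>E {1..}. \<forall>u v. adjacent G u v \<longrightarrow> \<kappa> u \<noteq> \<kappa> v}"

definition coloring_monomial :: "'a mgraph \<Rightarrow> ('a \<Rightarrow> nat) \<Rightarrow> nat multiset" where
  "coloring_monomial G \<kappa> = image_mset \<kappa> (mset_set (verts G))"

text \<open>The formal sum of the monomials \<open>x\<^bsub>\<kappa>(v\<^sub>1)\<^esub> \<cdots> x\<^bsub>\<kappa>(v\<^sub>n)\<^esub>\<close> has at the
  monomial \<open>m\<close> the number of proper colorings \<open>\<kappa>\<close> that give rise to \<open>m\<close>. By
  \<open>finite_colorings_with_monomial\<close> there are finitely many, and by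
  \<open>coloring_monomial_eq_prod\<close> the monomial is the product of indeterminates.\<close>

lift_definition chromatic_sf :: "'a mgraph \<Rightarrow> rat mps" is
  "\<lambda>G m. of_nat (card {\<kappa> \<in> proper_colorings G. coloring_monomial G \<kappa> = m})" .

lemma finite_colorings_with_monomial:
  assumes "finite (verts G)"
  shows "finite {\<kappa> \<in> proper_colorings G. coloring_monomial G \<kappa> = m}"
proof (rule finite_subset)
  show "{\<kappa> \<in> proper_colorings G. coloring_monomial G \<kappa> = m} \<subseteq> verts G \<rightarrow>\<^sub>E set_mset m"
    using assms by (auto simp: proper_colorings_def coloring_monomial_def PiE_iff extensional_def)
  show "finite (verts G \<rightarrow>\<^sub>E set_mset m)"
    using assms by (simp add: finite_PiE)
qed

lemma mps_coeff_var_mult: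
  "mps_coeff (mps_var i * f) m = (if i \<in># m then mps_coeff f (m - {#i#}) else 0)"
  for f :: "'k::comm_ring_1 mps"
proof transfer
  fix i m and f :: "nat multiset \<Rightarrow> 'k"
  have "(\<Sum>a\<in>{a. a \<subseteq># m}. (if a = {#i#} then 1 else 0) * f (m - a))
      = (\<Sum>a\<in>{a. a \<subseteq># m}. if a = {#i#} then f (m - a) else 0)"
    by (rule sum.cong) auto
  then show "(\<Sum>a\<in>{a. a \<subseteq># m}. (if a = {#i#} then 1 else 0) * f (m - a))
      = (if i \<in># m then f (m - {#i#}) else 0)"
    by simp
qed

lemma coloring_monomial_eq_prod:
  assumes "finite (verts G)"
  shows "mps_coeff (\<Prod>v\<in>verts G. mps_var (\<kappa> v) :: 'k::comm_ring_1 mps) m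
    = (if m = coloring_monomial G \<kappa> then 1 else 0)"
proof -
  have "mps_coeff (\<Prod>v\<in>V. mps_var (\<kappa> v) :: 'k mps) m
      = (if m = image_mset \<kappa> (mset_set V) then 1 else 0)" if "finite V" for V
    using that
  proof (induction V arbitrary: m rule: finite_induct)
    case empty
    then show ?case by (simp add: one_mps.rep_eq)
  next
    case (insert v V)
    then show ?case by (auto simp: mps_coeff_var_mult dest: insert_DiffM)
  qed
  then show ?thesis using assms by (simp add: coloring_monomial_def)
qed

definition star_sf :: "nat \<Rightarrow> rat mps" where
  "star_sf k = chromatic_sf (star_graph k)"

definition star_sf_partition :: "nat multiset \<Rightarrow> rat mps" where
  "star_sf_partition \<mu> = (\<Prod>k\<in>#\<mu>. star_sf k)"


section \<open>The Star-Expansion algorithm\<close>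

definition delete_edge :: "'a mgraph \<Rightarrow> 'a set \<Rightarrow> 'a mgraph" where
  "delete_edge H e = MGraph (verts H) (edges H - {#e#})"

definition simplification :: "'a mgraph \<Rightarrow> 'a mgraph" where
  "simplification H = MGraph (verts H) (mset_set {e. e \<in># edges H \<and> card e = 2})"

text \<open>\<open>H \<odot> e\<close>, where \<open>p\<close> is the merged vertex \<open>v'\<close> and \<open>q\<close> is the added vertex \<open>v''\<close>.
  Edges parallel to \<open>e\<close> become loops at \<open>p\<close>.\<close>

definition dot_contract :: "'a mgraph \<Rightarrow> 'a set \<Rightarrow> 'a \<Rightarrow> 'a \<Rightarrow> 'a mgraph" where
  "dot_contract H e p q =
     MGraph ((verts H - e) \<union> {p, q})
       (add_mset {p, q}
         (image_mset (image (\<lambda>x. if x \<in> e then p else x)) (edges H - {#e#})))"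

datatype edge_sign = Plus | Minus

datatype 'l signed_tree = Node 'l "(edge_sign \<times> 'l signed_tree) list"

fun leaf_labels :: "'l signed_tree \<Rightarrow> 'l multiset" where
  "leaf_labels (Node H []) = {#H#}"
| "leaf_labels (Node H (c # cs)) = (\<Sum>(s, t)\<leftarrow>c # cs. leaf_labels t)"

text \<open>One pass of the loop. The names \<open>p\<close> and \<open>q\<close> of the two new vertices are arbitrary, as long
  as they differ from each other and from the vertices that survive the contraction; the names
  of the endpoints of \<open>e\<close>, which disappear, may be used again.\<close>

inductive expansion_step :: "'a mgraph signed_tree \<Rightarrow> 'a mgraph signed_tree \<Rightarrow> bool" where
  expand: "\<lbrakk>internal_edge H e; p \<noteq> q; p \<notin> verts H - e; q \<notin> verts H - e;
      K = simplification (dot_contract H e p q)\<rbrakk> \<Longrightarrow>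
    expansion_step (Node H [])
      (Node H
        [(Plus, Node (delete_edge H e) []),
         (Plus, Node K []),
         (Minus, Node (delete_edge K {p, q}) [])])"
| descend: "expansion_step t t' \<Longrightarrow>
    expansion_step (Node H (as @ (s, t) # bs)) (Node H (as @ (s, t') # bs))"

definition star_expansion_output :: "'a mgraph \<Rightarrow> 'a mgraph signed_tree \<Rightarrow> bool" where
  "star_expansion_output G T \<longleftrightarrow>
     expansion_step\<^sup>*\<^sup>* (Node G []) T \<and>
     (\<forall>H\<in>#leaf_labels T. \<nexists>e. internal_edge H e)"

definition expansion_sign :: "'a mgraph \<Rightarrow> 'a mgraph \<Rightarrow> rat" where
  "expansion_sign G H = (-1) powi (int (isolated_count H) - int (isolated_count G))"

end

theory Submission
  imports Defs
begin

text \<open>Proper colorings of \<open>H \ e\<close> that give both ends of \<open>e\<close> the same color correspond, with the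
  same monomial, to proper colorings of \<open>(H \<odot> e)\<^sup>s \ \<ell>\<^sub>e\<close> that give both ends of \<open>\<ell>\<^sub>e\<close> the same
  color. Hence \<open>X\<close> satisfies the three-term relation of one pass of the loop. For an internal edge
  the number of isolated vertices is unchanged in the two children marked \<open>+\<close> and grows by one in
  the child marked \<open>-\<close>, so the signed sum of \<open>X\<^sub>H\<close> over the leaves is invariant. A graph without
  internal edges is a disjoint union of stars, where \<open>X\<close> is multiplicative. Signs cannot clash
  because the number of isolated vertices is the number of parts equal to 1 of the partition.\<close>

section \<open>Simple graphs\<close>

lemma simple_graph_finite: "simple_graph G \<Longrightarrow> finite (verts G)"
  by (simp add: simple_graph_def)

lemma adjacent_sym: "adjacent G u v \<longleftrightarrow> adjacent G v u"
  by (simp add: adjacent_def insert_commute)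

lemma simple_graph_adjacentD:
  assumes "simple_graph G" "adjacent G u v"
  shows "u \<in> verts G" "v \<in> verts G" "u \<noteq> v"
proof -
  have "{u, v} \<subseteq> verts G" "card {u, v} = 2"
    using assms unfolding simple_graph_def adjacent_def by blast+
  then show "u \<in> verts G" "v \<in> verts G" "u \<noteq> v" by auto
qed

lemma simple_graph_edgeE:
  assumes "simple_graph G" "e \<in># edges G"
  obtains u v where "e = {u, v}" "u \<noteq> v" "adjacent G u v"
proof -
  have "card e = 2" using assms by (auto simp: simple_graph_def)
  then obtain u v where "e = {u, v}" "u \<noteq> v" by (auto simp: card_2_iff)
  with assms show thesis using that by (auto simp: adjacent_def)
qed

text \<open>No edge is repeated in a simple graph. Rewriting with this turns sizes of filtered edge
  multisets into cardinalities of sets.\<close>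

lemma simple_graph_edges_eq:
  assumes "simple_graph G"
  shows "edges G = mset_set (set_mset (edges G))"
  using assms
  by (intro multiset_eqI) (auto simp: simple_graph_def count_mset_set' count_eq_zero_iff)

lemma finite_neighbours: "simple_graph G \<Longrightarrow> finite {w. adjacent G v w}"
  by (rule finite_subset[of _ "verts G"]) (auto dest: simple_graph_adjacentD simple_graph_finite)

text \<open>There are no loops, and \<open>w\<close> is recovered from the edge
  \<open>{v, w}\<close>, so neighbours of \<open>v\<close> and edges at \<open>v\<close> are in
  bijection.\<close>

lemma vertex_degree_eq_card_neighbours:
  assumes "simple_graph G"
  shows "vertex_degree G v = card {w. adjacent G v w}"
proof -
  have loop: "count (edges G) {v} = 0"
    using assms by (auto simp: simple_graph_def count_eq_zero_iff)
  have "size {#e \<in># edges G. v \<in> e#} = card {e \<in> set_mset (edges G). v \<in> e}"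
    by (subst simple_graph_edges_eq[OF assms]) simp
  also have "{e \<in> set_mset (edges G). v \<in> e} = (\<lambda>w. {v, w}) ` {w. adjacent G v w}"
  proof (intro equalityI subsetI)
    fix e assume e: "e \<in> {e \<in> set_mset (edges G). v \<in> e}"
    then obtain a b where ab: "e = {a, b}" "adjacent G a b"
      by (auto elim: simple_graph_edgeE[OF assms])
    with e have "v = a \<or> v = b" by auto
    then show "e \<in> (\<lambda>w. {v, w}) ` {w. adjacent G v w}"
      using ab adjacent_sym[of G a b] by (auto simp: insert_commute)
  qed (auto simp: adjacent_def)
  also have "card \<dots> = card {w. adjacent G v w}"
    by (rule card_image) (auto simp: inj_on_def doubleton_eq_iff)
  finally show ?thesis using loop by (simp add: vertex_degree_def)
qed

lemma vertex_degree_eq_0_iff: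
  assumes "simple_graph G"
  shows "vertex_degree G v = 0 \<longleftrightarrow> (\<forall>w. \<not> adjacent G v w)"
  by (simp add: vertex_degree_eq_card_neighbours[OF assms] finite_neighbours[OF assms])

text \<open>The form in which internal edges are used: an end of degree greater than 1 has a
  neighbour besides the other end.\<close>

lemma vertex_degree_gt_1_iff:
  assumes "simple_graph G"
  shows "vertex_degree G v > 1 \<longleftrightarrow> (\<exists>a b. a \<noteq> b \<and> adjacent G v a \<and> adjacent G v b)"
proof -
  have "card S > 1 \<longleftrightarrow> (\<exists>a b. a \<noteq> b \<and> a \<in> S \<and> b \<in> S)" if "finite S" for S :: "'a set"
    using that by (metis One_nat_def card_le_Suc0_iff_eq linorder_not_less)
  from this[OF finite_neighbours[OF assms]] show ?thesis
    by (simp add: vertex_degree_eq_card_neighbours[OF assms])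
qed

lemma isolated_count_simple:
  assumes "simple_graph G"
  shows "isolated_count G = card {v \<in> verts G. \<forall>w. \<not> adjacent G v w}"
  by (simp add: isolated_count_def vertex_degree_eq_0_iff[OF assms])

section \<open>Adjacency after deletion and simplification\<close>

lemma verts_delete_edge [simp]: "verts (delete_edge G e) = verts G"
  by (simp add: delete_edge_def)

text \<open>Multiset difference removes a single copy of \<open>e\<close>. In a simple graph this is
  the only copy, so the adjacency disappears.\<close>

lemma adjacent_delete_edge:
  assumes "simple_graph G"
  shows "adjacent (delete_edge G e) u v \<longleftrightarrow> adjacent G u v \<and> {u, v} \<noteq> e"
proof -
  have "count (edges G) {u, v} \<le> 1"
    using assms unfolding simple_graph_def
    by (cases "{u, v} \<in># edges G") (auto simp: not_in_iff)
  then show ?thesis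
    unfolding adjacent_def delete_edge_def mgraph.sel in_diff_count
    by (auto simp: not_in_iff Suc_le_eq count_single)
qed

lemma simple_graph_delete_edge:
  assumes "simple_graph G"
  shows "simple_graph (delete_edge G e)"
  unfolding simple_graph_def
proof (intro conjI ballI)
  show "finite (verts (delete_edge G e))" using assms by (simp add: simple_graph_def)
  fix f assume f: "f \<in># edges (delete_edge G e)"
  then have "f \<in># edges G" by (auto simp: delete_edge_def dest: in_diffD)
  then have *: "f \<subseteq> verts G" "card f = 2" "count (edges G) f = 1"
    using assms by (auto simp: simple_graph_def)
  then show "f \<subseteq> verts (delete_edge G e)" "card f = 2" by simp_all
  have "count (edges (delete_edge G e)) f \<le> 1"
    using *(3) by (simp add: delete_edge_def)
  moreover have "count (edges (delete_edge G e)) f > 0" using f by simp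
  ultimately show "count (edges (delete_edge G e)) f = 1" by linarith
qed

lemma simple_graph_simplification:
  assumes "finite (verts G)" "\<And>e. e \<in># edges G \<Longrightarrow> e \<subseteq> verts G"
  shows "simple_graph (simplification G)"
  using assms by (auto simp: simple_graph_def simplification_def)

lemma adjacent_simplification:
  "adjacent (simplification G) u v \<longleftrightarrow> adjacent G u v \<and> u \<noteq> v"
  by (auto simp: adjacent_def simplification_def card_2_iff)

section \<open>Deletion and near-contraction\<close>

lemma proper_coloringsI:
  assumes "\<kappa> \<in> verts G \<rightarrow>\<^sub>E {1..}" "\<And>u v. adjacent G u v \<Longrightarrow> \<kappa> u \<noteq> \<kappa> v"
  shows "\<kappa> \<in> proper_colorings G"
  using assms by (auto simp: proper_colorings_def)

text \<open>Proper colorings of the graph without \<open>{u, v}\<close> are split by whether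
  \<open>u\<close> and \<open>v\<close> get different colors. Those with different colors are
  exactly the proper colorings of \<open>G\<close>; the others form the correction term.\<close>

lemma chromatic_sf_delete_edge:
  assumes "simple_graph G" "adjacent G u v"
  shows "mps_coeff (chromatic_sf (delete_edge G {u, v})) m = mps_coeff (chromatic_sf G) m +
    of_nat (card {\<kappa> \<in> proper_colorings (delete_edge G {u, v}).
      coloring_monomial (delete_edge G {u, v}) \<kappa> = m \<and> \<kappa> u = \<kappa> v})"
proof -
  let ?D = "delete_edge G {u, v}"
  let ?A = "{\<kappa> \<in> proper_colorings ?D. coloring_monomial ?D \<kappa> = m}"
  let ?B = "{\<kappa> \<in> proper_colorings G. coloring_monomial G \<kappa> = m}"
  let ?C = "{\<kappa> \<in> proper_colorings ?D. coloring_monomial ?D \<kappa> = m \<and> \<kappa> u = \<kappa> v}"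
  have vu: "adjacent G v u" using assms(2) adjacent_sym by metis
  have adj: "adjacent G x y \<longleftrightarrow> adjacent ?D x y \<or> (x = u \<and> y = v) \<or> (x = v \<and> y = u)" for x y
    using assms(2) vu by (auto simp: adjacent_delete_edge[OF assms(1)] doubleton_eq_iff)
  have "proper_colorings G = {\<kappa> \<in> proper_colorings ?D. \<kappa> u \<noteq> \<kappa> v}"
  proof (rule set_eqI)
    fix \<kappa> :: "'a \<Rightarrow> nat"
    have "(\<forall>x y. adjacent G x y \<longrightarrow> \<kappa> x \<noteq> \<kappa> y) \<longleftrightarrow>
        (\<forall>x y. adjacent ?D x y \<longrightarrow> \<kappa> x \<noteq> \<kappa> y) \<and> \<kappa> u \<noteq> \<kappa> v"
      unfolding adj by metis
    then show "\<kappa> \<in> proper_colorings G \<longleftrightarrow> \<kappa> \<in> {\<kappa> \<in> proper_colorings ?D. \<kappa> u \<noteq> \<kappa> v}"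
      unfolding proper_colorings_def verts_delete_edge mem_Collect_eq by blast
  qed
  then have "?A = ?B \<union> ?C"
    unfolding coloring_monomial_def verts_delete_edge by blast
  moreover have "?B \<inter> ?C = {}"
    using assms(2) by (auto simp: proper_colorings_def)
  moreover have "finite ?A"
    using finite_colorings_with_monomial[of ?D m] simple_graph_finite[OF assms(1)] by simp
  ultimately have "card ?A = card ?B + card ?C"
    using card_Un_disjoint[of ?B ?C] by (simp only: finite_Un)
  then show ?thesis by (simp add: chromatic_sf.rep_eq)
qed

text \<open>The situation of one pass of the loop. The names \<open>p\<close> and \<open>q\<close>
  may coincide with \<open>u\<close> or \<open>v\<close>, which vanish in the contraction.
  Internality of \<open>{u, v}\<close> enters separately, when isolated vertices are
  counted.\<close>

locale near_contraction =
  fixes H :: "'a mgraph" and u v p q :: 'a and K :: "'a mgraph"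
  assumes simple: "simple_graph H"
    and uv: "adjacent H u v"
    and pq: "p \<noteq> q" "p \<notin> verts H - {u, v}" "q \<notin> verts H - {u, v}"
    and K_def: "K = simplification (dot_contract H {u, v} p q)"
begin

text \<open>The vertex map of the contraction. Edges of \<open>K\<close> other than
  \<open>{p, q}\<close> are described as images under it, and colorings are pulled back along
  it.\<close>

definition merge :: "'a \<Rightarrow> 'a" where
  "merge x = (if x \<in> {u, v} then p else x)"

lemma u_neq_v: "u \<noteq> v" and u_in: "u \<in> verts H" and v_in: "v \<in> verts H"
  using simple_graph_adjacentD[OF simple uv] by auto

lemma verts_K [simp]: "verts K = verts H - {u, v} \<union> {p, q}"
  by (auto simp: K_def simplification_def dot_contract_def)

text \<open>If the name \<open>q\<close> is reused from \<open>u\<close> or \<open>v\<close>, that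
  old vertex is sent to \<open>p\<close>; otherwise \<open>q\<close> is not a vertex of
  \<open>H\<close>.\<close>

lemma merge_neq_q: "x \<in> verts H \<Longrightarrow> merge x \<noteq> q"
  using pq by (auto simp: merge_def)

lemma merge_in: "x \<in> verts H \<Longrightarrow> merge x \<in> verts K"
  by (auto simp: merge_def)

text \<open>Since \<open>p\<close> is not a surviving vertex, merging identifies only
  \<open>u\<close> with \<open>v\<close>. Hence contraction of a simple graph creates no
  loops.\<close>

lemma merge_neq:
  assumes "adjacent H a b" "{a, b} \<noteq> {u, v}"
  shows "merge a \<noteq> merge b"
  using simple_graph_adjacentD[OF simple assms(1)] assms(2) pq by (auto simp: merge_def)

lemma edges_minus: "e \<in># edges H - {#{u, v}#} \<longleftrightarrow> e \<in># edges H \<and> e \<noteq> {u, v}"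
proof (cases "e \<in># edges H")
  case True
  then obtain a b where "e = {a, b}" by (rule simple_graph_edgeE[OF simple])
  with adjacent_delete_edge[OF simple, of "{u, v}" a b] show ?thesis
    by (simp add: adjacent_def delete_edge_def)
next
  case False
  then show ?thesis by (meson in_diffD)
qed

text \<open>Simplification leaves adjacency unchanged here: parallel edges do not affect it, and
  there are no loops to delete by \<open>merge_neq\<close>.\<close>

lemma adjacent_K:
  "adjacent K x y \<longleftrightarrow> {x, y} = {p, q} \<or>
    (\<exists>a b. adjacent H a b \<and> {a, b} \<noteq> {u, v} \<and> x = merge a \<and> y = merge b)"
proof -
  have "(\<lambda>x. if x \<in> {u, v} then p else x) = merge"
    by (simp add: merge_def fun_eq_iff)
  then have edges: "edges (dot_contract H {u, v} p q) =
      add_mset {p, q} (image_mset (image merge) (edges H - {#{u, v}#}))"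
    by (simp only: dot_contract_def mgraph.sel)
  have "adjacent K x y \<longleftrightarrow> x \<noteq> y \<and> ({x, y} = {p, q} \<or>
      (\<exists>e. e \<in># edges H \<and> e \<noteq> {u, v} \<and> {x, y} = merge ` e))"
    unfolding K_def adjacent_simplification unfolding adjacent_def edges
    by (simp add: image_iff Bex_def edges_minus conj_ac)
  also have "(\<exists>e. e \<in># edges H \<and> e \<noteq> {u, v} \<and> {x, y} = merge ` e) \<longleftrightarrow>
      (\<exists>a b. adjacent H a b \<and> {a, b} \<noteq> {u, v} \<and> x = merge a \<and> y = merge b)" (is "?L \<longleftrightarrow> ?R")
  proof
    assume ?L
    then obtain e where e: "e \<in># edges H" "e \<noteq> {u, v}" "{x, y} = merge ` e" by blast
    from e(1) obtain a b where ab: "e = {a, b}" "adjacent H a b"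
      by (rule simple_graph_edgeE[OF simple])
    with e have "{x, y} = {merge a, merge b}" by simp
    then have "x = merge a \<and> y = merge b \<or> x = merge b \<and> y = merge a"
      by (auto simp: doubleton_eq_iff)
    \<comment> \<open>An edge does not order its ends, so the swapped pair covers the case
      \<open>x = merge b\<close>, \<open>y = merge a\<close>.\<close>
    moreover have "adjacent H b a" "{b, a} \<noteq> {u, v}"
      using ab e adjacent_sym[of H a b] by (auto simp: insert_commute)
    ultimately show ?R using ab e(2) by blast
  next
    assume ?R
    then obtain a b where "adjacent H a b" "{a, b} \<noteq> {u, v}" "x = merge a" "y = merge b"
      by blast
    then show ?L by (intro exI[of _ "{a, b}"]) (simp add: adjacent_def)
  qed
  finally show ?thesis using merge_neq pq(1) by (auto simp: doubleton_eq_iff)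
qed

lemma simple_K: "simple_graph K"
  unfolding K_def
proof (rule simple_graph_simplification)
  show "finite (verts (dot_contract H {u, v} p q))"
    using simple_graph_finite[OF simple] by (simp add: dot_contract_def)
  fix e assume "e \<in># edges (dot_contract H {u, v} p q)"
  then show "e \<subseteq> verts (dot_contract H {u, v} p q)"
    using simple by (auto simp: dot_contract_def edges_minus simple_graph_def)
qed

text \<open>No image of an edge of \<open>H\<close> contains \<open>q\<close> by
  \<open>merge_neq_q\<close>, so deleting \<open>{p, q}\<close> removes only the added edge.\<close>

lemma adjacent_K_delete:
  "adjacent (delete_edge K {p, q}) x y \<longleftrightarrow>
    (\<exists>a b. adjacent H a b \<and> {a, b} \<noteq> {u, v} \<and> x = merge a \<and> y = merge b)"
  using simple_graph_adjacentD[OF simple] merge_neq_q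
  by (auto simp: adjacent_delete_edge[OF simple_K] adjacent_K doubleton_eq_iff) blast+

text \<open>The added vertex \<open>q\<close> replaces the vertex lost in the contraction:
  \<open>p\<close> and \<open>q\<close> contribute the color \<open>c\<close> twice, just as
  \<open>u\<close> and \<open>v\<close> did. This is why a vertex is added when contracting.\<close>

lemma monomial_merge:
  assumes "\<And>x. x \<in> verts H - {u, v} \<Longrightarrow> \<kappa>' x = \<kappa> x"
    and "\<kappa> u = c" "\<kappa> v = c" "\<kappa>' p = c" "\<kappa>' q = c"
  shows "coloring_monomial K \<kappa>' = coloring_monomial H \<kappa>"
proof -
  let ?V = "verts H - {u, v}"
  have fin: "finite ?V" using simple_graph_finite[OF simple] by simp
  have "verts H = insert u (insert v ?V)" using u_in v_in by auto
  then have H: "mset_set (verts H) = {#u, v#} + mset_set ?V"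
    using fin u_neq_v by (metis Diff_iff add_mset_add_single finite.insertI insertCI insertE
        mset_set.insert union_mset_add_mset_left add_0)
  have "verts K = insert p (insert q ?V)" by auto
  then have "mset_set (verts K) = {#p, q#} + mset_set ?V"
    using fin pq by simp
  moreover have "image_mset \<kappa>' (mset_set ?V) = image_mset \<kappa> (mset_set ?V)"
    using assms(1) fin by (intro image_mset_cong) auto
  ultimately show ?thesis using H assms by (simp add: coloring_monomial_def)
qed

text \<open>A coloring that is constant on \<open>{u, v}\<close> factors through the contraction.
  The new vertex \<open>q\<close> then has no choice but to copy the color of \<open>p\<close>,
  which gives a bijection preserving monomials.\<close>

lemma card_colorings_merge:
  "card {\<kappa> \<in> proper_colorings (delete_edge H {u, v}).
      coloring_monomial (delete_edge H {u, v}) \<kappa> = m \<and> \<kappa> u = \<kappa> v} =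
   card {\<kappa> \<in> proper_colorings (delete_edge K {p, q}).
      coloring_monomial (delete_edge K {p, q}) \<kappa> = m \<and> \<kappa> p = \<kappa> q}"
  (is "card ?A = card ?B")
proof (rule bij_betw_same_card)
  \<comment> \<open>\<open>F\<close> transports colorings to the contraction, giving
    \<open>p\<close> and \<open>q\<close> the common color of \<open>u\<close> and \<open>v\<close>;
    its inverse \<open>F'\<close> is pullback along \<open>merge\<close>.\<close>
  define F where "F \<kappa> = (\<lambda>x\<in>verts K. if x \<in> {p, q} then \<kappa> u else \<kappa> x)" for \<kappa> :: "'a \<Rightarrow> nat"
  define F' where "F' \<kappa> = (\<lambda>x\<in>verts H. \<kappa> (merge x))" for \<kappa> :: "'a \<Rightarrow> nat"
  have mon_H: "coloring_monomial (delete_edge H {u, v}) = coloring_monomial H"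
    and mon_K: "coloring_monomial (delete_edge K {p, q}) = coloring_monomial K"
    by (simp_all add: coloring_monomial_def fun_eq_iff)
  have F_merge: "F \<kappa> (merge x) = \<kappa> x" if "\<kappa> u = \<kappa> v" "x \<in> verts H" for \<kappa> x
    using that pq by (auto simp: F_def merge_def)
  show "bij_betw F ?A ?B"
  proof (rule bij_betw_byWitness[where f' = F'])
    show "\<forall>\<kappa>\<in>?A. F' (F \<kappa>) = \<kappa>"
    proof
      fix \<kappa> assume "\<kappa> \<in> ?A"
      then have "\<kappa> \<in> extensional (verts H)" "\<kappa> u = \<kappa> v"
        by (auto simp: proper_colorings_def PiE_iff)
      then show "F' (F \<kappa>) = \<kappa>"
        by (auto simp: F'_def fun_eq_iff F_merge extensional_def)
    qed
    show "\<forall>\<kappa>\<in>?B. F (F' \<kappa>) = \<kappa>"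
    proof
      fix \<kappa> assume "\<kappa> \<in> ?B"
      then have *: "\<kappa> \<in> extensional (verts K)" "\<kappa> p = \<kappa> q"
        by (auto simp: proper_colorings_def PiE_iff)
      show "F (F' \<kappa>) = \<kappa>"
      proof
        \<comment> \<open>At \<open>p\<close> and \<open>q\<close> the left side is \<kappa> at
          \<open>merge u\<close>, that is at \<open>p\<close>; elsewhere on \<open>verts K\<close>
          the map \<open>merge\<close> fixes \<open>x\<close>.\<close>
        fix x show "F (F' \<kappa>) x = \<kappa> x"
          using * u_in by (auto simp: F_def F'_def merge_def extensional_def)
      qed
    qed
    show "F ` ?A \<subseteq> ?B"
    proof (rule image_subsetI)
      fix \<kappa> assume "\<kappa> \<in> ?A"
      then have \<kappa>: "\<kappa> \<in> verts H \<rightarrow>\<^sub>E {1..}" "\<kappa> u = \<kappa> v" "coloring_monomial H \<kappa> = m"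
        and proper: "\<And>a b. adjacent H a b \<Longrightarrow> {a, b} \<noteq> {u, v} \<Longrightarrow> \<kappa> a \<noteq> \<kappa> b"
        by (auto simp: proper_colorings_def adjacent_delete_edge[OF simple] mon_H)
      have "F \<kappa> \<in> proper_colorings (delete_edge K {p, q})"
      proof (rule proper_coloringsI)
        show "F \<kappa> \<in> verts (delete_edge K {p, q}) \<rightarrow>\<^sub>E {1..}"
          using \<kappa>(1) u_in by (auto simp: F_def PiE_iff)
        fix x y assume "adjacent (delete_edge K {p, q}) x y"
        then obtain a b where "adjacent H a b" "{a, b} \<noteq> {u, v}" "x = merge a" "y = merge b"
          by (auto simp: adjacent_K_delete)
        then show "F \<kappa> x \<noteq> F \<kappa> y"
          using proper F_merge[OF \<kappa>(2)] simple_graph_adjacentD[OF simple] by metis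
      qed
      moreover have "coloring_monomial K (F \<kappa>) = coloring_monomial H \<kappa>"
        using \<kappa>(2) pq by (intro monomial_merge[where c = "\<kappa> u"]) (auto simp: F_def)
      moreover have "F \<kappa> p = F \<kappa> q" by (simp add: F_def)
      ultimately show "F \<kappa> \<in> ?B" using \<kappa>(3) by (simp add: mon_K)
    qed
    show "F' ` ?B \<subseteq> ?A"
    proof (rule image_subsetI)
      fix \<kappa> assume "\<kappa> \<in> ?B"
      then have \<kappa>: "\<kappa> \<in> verts K \<rightarrow>\<^sub>E {1..}" "\<kappa> p = \<kappa> q" "coloring_monomial K \<kappa> = m"
        and proper: "\<And>x y. adjacent (delete_edge K {p, q}) x y \<Longrightarrow> \<kappa> x \<noteq> \<kappa> y"
        by (auto simp: proper_colorings_def mon_K)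
      have "F' \<kappa> \<in> proper_colorings (delete_edge H {u, v})"
      proof (rule proper_coloringsI)
        show "F' \<kappa> \<in> verts (delete_edge H {u, v}) \<rightarrow>\<^sub>E {1..}"
          using \<kappa>(1) merge_in by (auto simp: F'_def PiE_iff simp del: verts_K)
        fix a b assume "adjacent (delete_edge H {u, v}) a b"
        then have ab: "adjacent H a b" "{a, b} \<noteq> {u, v}"
          by (auto simp: adjacent_delete_edge[OF simple])
        then have "\<kappa> (merge a) \<noteq> \<kappa> (merge b)"
          by (intro proper) (auto simp: adjacent_K_delete)
        then show "F' \<kappa> a \<noteq> F' \<kappa> b"
          using simple_graph_adjacentD[OF simple ab(1)] by (simp add: F'_def)
      qed
      moreover have "coloring_monomial K \<kappa> = coloring_monomial H (F' \<kappa>)"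
        using \<kappa>(2) u_in v_in
        by (intro monomial_merge[where c = "\<kappa> p"]) (auto simp: F'_def merge_def)
      moreover have "F' \<kappa> u = F' \<kappa> v" using u_in v_in by (simp add: F'_def merge_def)
      ultimately show "F' \<kappa> \<in> ?A" using \<kappa>(3) by (simp add: mon_H)
    qed
  qed
qed

text \<open>Splitting by equal colors at the ends, once for \<open>{u, v}\<close> in
  \<open>H\<close> and once for \<open>{p, q}\<close> in \<open>K\<close>, yields correction terms
  that agree by \<open>card_colorings_merge\<close> and cancel.\<close>

lemma chromatic_sf_near_contraction:
  "chromatic_sf H =
    chromatic_sf (delete_edge H {u, v}) + chromatic_sf K - chromatic_sf (delete_edge K {p, q})"
proof -
  have "adjacent K p q" by (simp add: adjacent_K)
  from chromatic_sf_delete_edge[OF simple_K this] chromatic_sf_delete_edge[OF simple uv]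
  show ?thesis
    by (simp add: mps_eq_iff plus_mps.rep_eq minus_mps.rep_eq card_colorings_merge)
qed

section \<open>Isolated vertices in the three children\<close>

lemma isolated_count_delete:
  assumes "internal_edge H {u, v}"
  shows "isolated_count (delete_edge H {u, v}) = isolated_count H"
proof -
  have "(\<forall>w. \<not> adjacent (delete_edge H {u, v}) x w) \<longleftrightarrow> (\<forall>w. \<not> adjacent H x w)" for x
  proof (cases "x \<in> {u, v}")
    case True
    then have "vertex_degree H x > 1" using assms by (auto simp: internal_edge_def)
    then obtain a b where "a \<noteq> b" "adjacent H x a" "adjacent H x b"
      using vertex_degree_gt_1_iff[OF simple] by blast
    \<comment> \<open>Deleting \<open>{u, v}\<close> costs \<open>x\<close> at most one neighbour,
      so \<open>a\<close> or \<open>b\<close> remains.\<close>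
    then show ?thesis
      by (auto simp: adjacent_delete_edge[OF simple] doubleton_eq_iff)
  next
    case False
    then show ?thesis by (auto simp: adjacent_delete_edge[OF simple])
  qed
  then show ?thesis
    by (simp add: isolated_count_simple simple simple_graph_delete_edge)
qed

text \<open>Such an \<open>x\<close> is its own only preimage under \<open>merge\<close>, and none
  of its edges is the contracted one.\<close>

lemma isolated_K_delete_iff:
  assumes "x \<in> verts H - {u, v}"
  shows "(\<forall>w. \<not> adjacent (delete_edge K {p, q}) x w) \<longleftrightarrow> (\<forall>w. \<not> adjacent H x w)"
proof -
  have "merge a = x \<longleftrightarrow> a = x" for a using assms pq by (auto simp: merge_def)
  then have "(\<exists>w. adjacent (delete_edge K {p, q}) x w) \<longleftrightarrow>
      (\<exists>b. adjacent H x b \<and> {x, b} \<noteq> {u, v})"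
    unfolding adjacent_K_delete by metis
  then show ?thesis using assms by auto
qed

lemma isolated_count_K: "isolated_count K = isolated_count H"
proof -
  have pq': "adjacent K p q" "adjacent K q p" by (auto simp: adjacent_K)
  have "(\<forall>w. \<not> adjacent K x w) \<longleftrightarrow> (\<forall>w. \<not> adjacent H x w)" if "x \<in> verts H - {u, v}" for x
    using isolated_K_delete_iff[OF that] that pq
    by (auto simp: adjacent_delete_edge[OF simple_K] doubleton_eq_iff)
  moreover have "\<not> (\<forall>w. \<not> adjacent H u w)" "\<not> (\<forall>w. \<not> adjacent H v w)"
    using uv adjacent_sym by metis+
  \<comment> \<open>The vertex sets differ only in \<open>u\<close>, \<open>v\<close> and
    \<open>p\<close>, \<open>q\<close>, and each of these has a neighbour in its own graph.\<close>
  ultimately have "{x \<in> verts K. \<forall>w. \<not> adjacent K x w} = {x \<in> verts H. \<forall>w. \<not> adjacent H x w}"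
    using pq' by auto
  then show ?thesis by (simp add: isolated_count_simple simple simple_K)
qed

text \<open>Without \<open>{p, q}\<close> the vertex \<open>q\<close> becomes isolated, while
  \<open>p\<close> keeps a neighbour because the contracted edge was internal.\<close>

lemma isolated_count_K_delete:
  assumes "internal_edge H {u, v}"
  shows "isolated_count (delete_edge K {p, q}) = Suc (isolated_count H)"
proof -
  let ?D = "delete_edge K {p, q}" and ?I = "{x \<in> verts H. \<forall>w. \<not> adjacent H x w}"
  have "vertex_degree H u > 1" using assms by (auto simp: internal_edge_def)
  then obtain a b where "a \<noteq> b" "adjacent H u a" "adjacent H u b"
    using vertex_degree_gt_1_iff[OF simple] by blast
  then obtain a where a: "adjacent H u a" "a \<noteq> v" by metis
  \<comment> \<open>Here \<open>p\<close> is \<open>merge u\<close>, and the edge from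
    \<open>u\<close> to \<open>a\<close> survives because \<open>a\<close> differs from
    \<open>v\<close>.\<close>
  then have "adjacent ?D p (merge a)"
    unfolding adjacent_K_delete
    by (intro exI[of _ u] exI[of _ a]) (auto simp: merge_def doubleton_eq_iff)
  moreover have "\<not> adjacent ?D q w" for w
    using merge_neq_q simple_graph_adjacentD[OF simple] unfolding adjacent_K_delete by metis
  moreover have "\<not> (\<forall>w. \<not> adjacent H u w)" "\<not> (\<forall>w. \<not> adjacent H v w)"
    using uv adjacent_sym by metis+
  ultimately have "{x \<in> verts ?D. \<forall>w. \<not> adjacent ?D x w} = insert q ?I"
    using isolated_K_delete_iff by (auto simp del: not_all)
  \<comment> \<open>If \<open>q\<close> is a vertex of \<open>H\<close> at all, it is
    \<open>u\<close> or \<open>v\<close>, which are not isolated there.\<close>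
  moreover have "q \<notin> ?I" using pq(3) uv adjacent_sym by (metis (lifting) Diff_iff insertE mem_Collect_eq singletonD)
  moreover have "finite ?I" using simple_graph_finite[OF simple] by simp
  ultimately show ?thesis
    by (simp add: isolated_count_simple simple simple_K simple_graph_delete_edge)
qed

end


section \<open>Invariance along the algorithm\<close>

lemma leaf_labels_Node: "cs \<noteq> [] \<Longrightarrow> leaf_labels (Node H cs) = (\<Sum>(s, t)\<leftarrow>cs. leaf_labels t)"
  by (cases cs) auto

text \<open>Forgets the position in the tree: a pass only exchanges one leaf label for three, and
  descending adds the same sibling leaves before and after.\<close>

lemma expansion_step_leaf_labels:
  assumes "expansion_step t t'"
  shows "\<exists>M H e p q K. leaf_labels t = add_mset H M \<and>
    leaf_labels t' = {#delete_edge H e, K, delete_edge K {p, q}#} + M \<and>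
    internal_edge H e \<and> p \<noteq> q \<and> p \<notin> verts H - e \<and> q \<notin> verts H - e \<and>
    K = simplification (dot_contract H e p q)"
  using assms
proof induction
  case (expand H e p q K)
  then show ?case
    by (intro exI[of _ "{#}"] exI[of _ H] exI[of _ e] exI[of _ p] exI[of _ q] exI[of _ K]) simp
next
  case (descend t t' L as s bs)
  then obtain M H e p q K where IH: "leaf_labels t = add_mset H M"
    "leaf_labels t' = {#delete_edge H e, K, delete_edge K {p, q}#} + M"
    "internal_edge H e" "p \<noteq> q" "p \<notin> verts H - e" "q \<notin> verts H - e"
    "K = simplification (dot_contract H e p q)"
    by blast
  let ?R = "(\<Sum>(s, t)\<leftarrow>as @ bs. leaf_labels t)"
  have node: "leaf_labels (Node L (as @ (s, x) # bs)) = leaf_labels x + ?R" for x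
    by (simp add: leaf_labels_Node)
  show ?case
    unfolding node
    by (rule exI[of _ "M + ?R"], rule exI[of _ H], rule exI[of _ e], rule exI[of _ p],
        rule exI[of _ q], rule exI[of _ K]) (use IH in simp)
qed

section \<open>Signs and the signed sum over the leaves\<close>

lemma mps_const_1 [simp]: "mps_const 1 = (1 :: 'k::comm_ring_1 mps)"
  by transfer (rule refl)

lemma mps_const_uminus: "mps_const (- a) = - (mps_const a :: 'k::comm_ring_1 mps)"
  by transfer auto

lemma expansion_sign_self [simp]: "expansion_sign G G = 1"
  by (simp add: expansion_sign_def)

lemma expansion_sign_cong:
  "isolated_count H = isolated_count H' \<Longrightarrow> expansion_sign G H = expansion_sign G H'"
  by (simp add: expansion_sign_def)

lemma expansion_sign_Suc:
  assumes "isolated_count H' = Suc (isolated_count H)"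
  shows "expansion_sign G H' = - expansion_sign G H"
proof -
  have eq: "int (isolated_count H') - int (isolated_count G) =
      (int (isolated_count H) - int (isolated_count G)) + 1"
    using assms by simp
  show ?thesis unfolding expansion_sign_def eq by (subst power_int_add) simp_all
qed

text \<open>The invariant uses \<open>chromatic_sf H\<close> in place of the star product, so that
  it is meaningful while leaves are not yet unions of stars.\<close>

definition leaf_sum :: "'a mgraph \<Rightarrow> 'a mgraph multiset \<Rightarrow> rat mps" where
  "leaf_sum G M = (\<Sum>H\<in>#M. mps_const (expansion_sign G H) * chromatic_sf H)"

text \<open>The signs of the three new leaves relative to that of \<open>H\<close> are plus, plus,
  minus, matching the three-term relation. Simplicity of the labels is carried along because the
  next pass relies on it.\<close>

lemma expansion_step_invariant:
  assumes "expansion_step t t'" "\<forall>H\<in>#leaf_labels t. simple_graph H"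
  shows "(\<forall>H\<in>#leaf_labels t'. simple_graph H) \<and>
    leaf_sum G (leaf_labels t') = leaf_sum G (leaf_labels t)"
proof -
  obtain M H e p q K where step: "leaf_labels t = add_mset H M"
    "leaf_labels t' = {#delete_edge H e, K, delete_edge K {p, q}#} + M"
    "internal_edge H e" "p \<noteq> q" "p \<notin> verts H - e" "q \<notin> verts H - e"
    "K = simplification (dot_contract H e p q)"
    using expansion_step_leaf_labels[OF assms(1)] by blast
  have H: "simple_graph H" using assms(2) step by simp
  have "e \<in># edges H" using step(3) by (simp add: internal_edge_def)
  then obtain u v where e: "e = {u, v}" "adjacent H u v" by (rule simple_graph_edgeE[OF H])
  interpret near_contraction H u v p q K
    using H e step by unfold_locales auto
  have "expansion_sign G (delete_edge H e) = expansion_sign G H"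
    "expansion_sign G K = expansion_sign G H"
    "expansion_sign G (delete_edge K {p, q}) = - expansion_sign G H"
    using isolated_count_delete isolated_count_K isolated_count_K_delete step(3)
    by (auto simp: e intro!: expansion_sign_cong expansion_sign_Suc)
  then have "leaf_sum G (leaf_labels t') = leaf_sum G M + mps_const (expansion_sign G H) *
      (chromatic_sf (delete_edge H e) + chromatic_sf K - chromatic_sf (delete_edge K {p, q}))"
    by (simp add: step leaf_sum_def mps_const_uminus algebra_simps)
  also have "\<dots> = leaf_sum G (leaf_labels t)"
    using chromatic_sf_near_contraction by (simp add: step(1) leaf_sum_def e(1))
  finally have "leaf_sum G (leaf_labels t') = leaf_sum G (leaf_labels t)" .
  moreover have "\<forall>H\<in>#leaf_labels t'. simple_graph H"
    using assms(2) simple simple_K by (auto simp: step simp del: K_def intro: simple_graph_delete_edge)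
  ultimately show ?thesis by blast
qed

lemma expansion_steps_invariant:
  assumes "expansion_step\<^sup>*\<^sup>* (Node G []) T" "simple_graph G"
  shows "(\<forall>H\<in>#leaf_labels T. simple_graph H) \<and> leaf_sum G (leaf_labels T) = chromatic_sf G"
  using assms(1)
proof induction
  case base
  then show ?case using assms(2) by (simp add: leaf_sum_def)
next
  case (step t t')
  then show ?case using expansion_step_invariant[of t t' G] by simp
qed

section \<open>Chromatic symmetric functions of disjoint unions\<close>

lemma verts_induced_subgraph [simp]: "verts (induced_subgraph G C) = C"
  by (simp add: induced_subgraph_def)

lemma adjacent_induced_subgraph:
  "adjacent (induced_subgraph G C) u v \<longleftrightarrow> adjacent G u v \<and> u \<in> C \<and> v \<in> C"
  by (auto simp: adjacent_def induced_subgraph_def)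

lemma induced_subgraph_verts:
  assumes "simple_graph G"
  shows "induced_subgraph G (verts G) = G"
proof -
  have "{#e \<in># edges G. e \<subseteq> verts G#} = edges G"
    using assms by (auto simp: simple_graph_def filter_mset_eq_conv)
  then show ?thesis by (simp add: induced_subgraph_def)
qed

text \<open>Without edges between \<open>A\<close> and \<open>B\<close>, a proper coloring is an
  independent pair of proper colorings. Sorting the pairs by the monomial on \<open>A\<close> gives
  the coefficient of the product.\<close>

lemma chromatic_sf_disjoint_Un:
  fixes G :: "'a mgraph"
  assumes fin: "finite A" "finite B" and disj: "A \<inter> B = {}"
    and cross: "\<And>u v. adjacent G u v \<Longrightarrow> u \<in> A \<Longrightarrow> v \<notin> B"
  shows "chromatic_sf (induced_subgraph G (A \<union> B)) =
    chromatic_sf (induced_subgraph G A) * chromatic_sf (induced_subgraph G B)"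
proof -
  define S where "S C m = {\<kappa> \<in> proper_colorings (induced_subgraph G C).
    coloring_monomial (induced_subgraph G C) \<kappa> = m}" for C m
  have fin_S: "finite (S C m)" if "finite C" for C m
    unfolding S_def using that by (intro finite_colorings_with_monomial) simp
  have S_iff: "\<kappa> \<in> S C m \<longleftrightarrow> \<kappa> \<in> C \<rightarrow>\<^sub>E {1..} \<and>
      (\<forall>u\<in>C. \<forall>v\<in>C. adjacent G u v \<longrightarrow> \<kappa> u \<noteq> \<kappa> v) \<and> image_mset \<kappa> (mset_set C) = m" for \<kappa> C m
    by (auto simp: S_def proper_colorings_def coloring_monomial_def adjacent_induced_subgraph)
  have mset_Un: "image_mset \<kappa> (mset_set (A \<union> B)) =
      image_mset \<kappa> (mset_set A) + image_mset \<kappa> (mset_set B)" for \<kappa> :: "'a \<Rightarrow> nat"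
    using fin disj by (simp add: mset_set_Union)
  have mset_cong: "image_mset \<kappa> (mset_set C) = image_mset \<kappa>' (mset_set C)"
    if "\<And>x. x \<in> C \<Longrightarrow> \<kappa> x = \<kappa>' x" "finite C" for \<kappa> \<kappa>' :: "'a \<Rightarrow> nat" and C
    using that by (intro image_mset_cong) auto
  have "card (S (A \<union> B) m) = (\<Sum>a\<in>{a. a \<subseteq># m}. card (S A a) * card (S B (m - a)))" for m
  proof -
    \<comment> \<open>The first entry \<open>a\<close> is determined by the coloring of
      \<open>A\<close>; recording it makes the cardinality of \<open>R\<close> the convolution
      sum.\<close>
    define R where "R = (SIGMA a:{a. a \<subseteq># m}. S A a \<times> S B (m - a))"
    define split where "split \<kappa> = (image_mset \<kappa> (mset_set A), restrict \<kappa> A, restrict \<kappa> B)"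
      for \<kappa> :: "'a \<Rightarrow> nat"
    define join where "join = (\<lambda>(a :: nat multiset, \<kappa>1, \<kappa>2).
      \<lambda>x\<in>A \<union> B. if x \<in> A then \<kappa>1 x else \<kappa>2 x :: nat)"
    have "bij_betw split (S (A \<union> B) m) R"
    proof (rule bij_betw_byWitness[where f' = join])
      show "\<forall>\<kappa>\<in>S (A \<union> B) m. join (split \<kappa>) = \<kappa>"
        by (auto simp: S_iff join_def split_def fun_eq_iff PiE_iff extensional_def)
      show "split ` S (A \<union> B) m \<subseteq> R"
      proof (rule image_subsetI)
        fix \<kappa> assume \<kappa>: "\<kappa> \<in> S (A \<union> B) m"
        have "image_mset (restrict \<kappa> A) (mset_set A) = image_mset \<kappa> (mset_set A)"
          "image_mset (restrict \<kappa> B) (mset_set B) = image_mset \<kappa> (mset_set B)"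
          using fin by (auto intro: mset_cong)
        moreover have "m = image_mset \<kappa> (mset_set A) + image_mset \<kappa> (mset_set B)"
          using \<kappa> by (simp add: S_iff mset_Un)
        ultimately show "split \<kappa> \<in> R"
          using \<kappa> by (auto simp: R_def split_def S_iff)
      qed
      show "join ` R \<subseteq> S (A \<union> B) m"
      proof (rule image_subsetI)
        fix x assume "x \<in> R"
        then obtain a \<kappa>1 \<kappa>2 where x: "x = (a, \<kappa>1, \<kappa>2)" and a: "a \<subseteq># m"
          and \<kappa>1: "\<kappa>1 \<in> S A a" and \<kappa>2: "\<kappa>2 \<in> S B (m - a)"
          by (auto simp: R_def)
        let ?\<kappa> = "join x"
        have A: "?\<kappa> y = \<kappa>1 y" if "y \<in> A" for y using that by (simp add: x join_def)
        have B: "?\<kappa> y = \<kappa>2 y" if "y \<in> B" for y using that disj by (auto simp: x join_def)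
        have "image_mset ?\<kappa> (mset_set A) = a" "image_mset ?\<kappa> (mset_set B) = m - a"
          using \<kappa>1 \<kappa>2 mset_cong[OF A] mset_cong[OF B] fin by (auto simp: S_iff)
        \<comment> \<open>Multiset subtraction is truncated, so \<open>a + (m - a) = m\<close>
          relies on \<open>a\<close> being contained in \<open>m\<close>.\<close>
        then have "image_mset ?\<kappa> (mset_set (A \<union> B)) = m" using a by (simp add: mset_Un)
        moreover have "?\<kappa> \<in> A \<union> B \<rightarrow>\<^sub>E {1..}"
          using \<kappa>1 \<kappa>2 by (auto simp: S_iff x join_def PiE_iff)
        moreover have "?\<kappa> u \<noteq> ?\<kappa> v" if "adjacent G u v" "u \<in> A \<union> B" "v \<in> A \<union> B" for u v
        proof -
          have "adjacent G v u" using that(1) adjacent_sym by metis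
          with that cross consider "u \<in> A" "v \<in> A" | "u \<in> B" "v \<in> B" by blast
          then show ?thesis using \<kappa>1 \<kappa>2 that(1) by cases (auto simp: A B S_iff)
        qed
        ultimately show "?\<kappa> \<in> S (A \<union> B) m" by (simp add: S_iff)
      qed
      show "\<forall>x\<in>R. split (join x) = x"
      proof
        fix x assume "x \<in> R"
        then obtain a \<kappa>1 \<kappa>2 where x: "x = (a, \<kappa>1, \<kappa>2)"
          and \<kappa>1: "\<kappa>1 \<in> S A a" and \<kappa>2: "\<kappa>2 \<in> S B (m - a)"
          by (auto simp: R_def)
        have A: "join x y = \<kappa>1 y" if "y \<in> A" for y using that by (simp add: x join_def)
        have B: "join x y = \<kappa>2 y" if "y \<in> B" for y using that disj by (auto simp: x join_def)
        have "image_mset (join x) (mset_set A) = a"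
          using \<kappa>1 mset_cong[OF A] fin by (simp add: S_iff)
        moreover have "restrict (join x) A = \<kappa>1" "restrict (join x) B = \<kappa>2"
          using \<kappa>1 \<kappa>2 A B by (auto simp: S_iff fun_eq_iff PiE_iff extensional_def)
        ultimately show "split (join x) = x" by (simp add: split_def x)
      qed
    qed
    then have "card (S (A \<union> B) m) = card R" by (rule bij_betw_same_card)
    also have "\<dots> = (\<Sum>a\<in>{a. a \<subseteq># m}. card (S A a \<times> S B (m - a)))"
      unfolding R_def using fin by (intro card_SigmaI) (auto intro: fin_S)
    finally show ?thesis by (simp add: card_cartesian_product)
  qed
  then show ?thesis
    by (simp add: mps_eq_iff times_mps.rep_eq chromatic_sf.rep_eq flip: S_def)
qed

text \<open>The graph without vertices has one coloring, the function that is
  \<open>undefined\<close> everywhere, and its monomial is empty.\<close>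

lemma chromatic_sf_empty: "chromatic_sf (induced_subgraph G {}) = 1"
proof -
  have "{\<kappa> \<in> proper_colorings (induced_subgraph G {}).
      coloring_monomial (induced_subgraph G {}) \<kappa> = m} = (if m = {#} then {\<lambda>_. undefined} else {})"
    for m
    by (auto simp: proper_colorings_def adjacent_induced_subgraph coloring_monomial_def)
  then show ?thesis by (simp add: mps_eq_iff chromatic_sf.rep_eq one_mps.rep_eq)
qed

lemma chromatic_sf_disjoint_Union:
  assumes "finite \<C>" "\<And>C. C \<in> \<C> \<Longrightarrow> finite C" "pairwise disjnt \<C>"
    and "\<And>C u v. C \<in> \<C> \<Longrightarrow> adjacent G u v \<Longrightarrow> u \<in> C \<Longrightarrow> v \<in> C"
  shows "chromatic_sf (induced_subgraph G (\<Union>\<C>)) =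
    (\<Prod>C\<in>\<C>. chromatic_sf (induced_subgraph G C))"
  using assms
proof (induction \<C> rule: finite_induct)
  case empty
  then show ?case by (simp add: chromatic_sf_empty)
next
  case (insert C \<C>)
  have disj: "C \<inter> \<Union>\<C> = {}"
    using insert.prems(2) insert.hyps by (auto simp: pairwise_insert disjnt_def)
  have "chromatic_sf (induced_subgraph G (C \<union> \<Union>\<C>)) =
      chromatic_sf (induced_subgraph G C) * chromatic_sf (induced_subgraph G (\<Union>\<C>))"
  proof (rule chromatic_sf_disjoint_Un)
    show "finite C" "finite (\<Union>\<C>)" using insert by auto
    show "C \<inter> \<Union>\<C> = {}" by (fact disj)
    fix u v assume "adjacent G u v" "u \<in> C"
    then have "v \<in> C" using insert.prems(3)[of C] by blast
    then show "v \<notin> \<Union>\<C>" using disj by blast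
  qed
  moreover have "chromatic_sf (induced_subgraph G (\<Union>\<C>)) =
      (\<Prod>C\<in>\<C>. chromatic_sf (induced_subgraph G C))"
    using insert.prems by (intro insert.IH) (auto simp: pairwise_insert)
  ultimately show ?case using insert.hyps by simp
qed

text \<open>Colorings are transported by composing with the vertex bijection and its inverse. Edges
  must lie within \<open>verts G\<close>, since \<open>graph_iso\<close> controls \<open>f\<close>
  only there.\<close>

lemma chromatic_sf_iso:
  assumes "graph_iso G H" "\<And>e. e \<in># edges G \<Longrightarrow> e \<subseteq> verts G"
  shows "chromatic_sf G = chromatic_sf H"
proof -
  obtain f where f: "bij_betw f (verts G) (verts H)"
    and edges: "image_mset (image f) (edges G) = edges H"
    using assms(1) by (auto simp: graph_iso_def)
  have inj: "inj_on f (verts G)" and img: "f ` verts G = verts H"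
    using f by (auto simp: bij_betw_def)
  have adj_verts: "u \<in> verts G \<and> v \<in> verts G" if "adjacent G u v" for u v
    using assms(2)[of "{u, v}"] that by (simp add: adjacent_def)
  have adj: "adjacent H (f u) (f v) \<longleftrightarrow> adjacent G u v" if uv: "u \<in> verts G" "v \<in> verts G" for u v
  proof
    assume "adjacent H (f u) (f v)"
    then have "f ` {u, v} \<in> image f ` set_mset (edges G)"
      by (simp add: adjacent_def flip: edges)
    then obtain e where e: "e \<in># edges G" "f ` {u, v} = f ` e" by blast
    \<comment> \<open>Injectivity on vertices lifts to subsets of \<open>verts G\<close>, so equal
      image edges come from equal edges.\<close>
    then have "{u, v} = e"
      using inj_on_image_eq_iff[OF inj, of "{u, v}" e] assms(2) uv by blast
    then show "adjacent G u v" using e by (simp add: adjacent_def)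
  next
    assume "adjacent G u v"
    then have "f ` {u, v} \<in> image f ` set_mset (edges G)"
      unfolding adjacent_def by (rule imageI)
    then show "adjacent H (f u) (f v)" by (simp add: adjacent_def flip: edges)
  qed
  have adj_H: "\<exists>u\<in>verts G. \<exists>v\<in>verts G. x = f u \<and> y = f v" if "adjacent H x y" for x y
  proof -
    have "{x, y} \<in> image f ` set_mset (edges G)"
      using that by (simp add: adjacent_def flip: edges)
    then obtain e where "e \<in># edges G" "{x, y} = f ` e" by blast
    then show ?thesis using assms(2)[of e] by blast
  qed
  let ?g = "inv_into (verts G) f"
  have g: "?g x \<in> verts G" "f (?g x) = x" if "x \<in> verts H" for x
    using that img by (auto intro: inv_into_into f_inv_into_f)
  have gf: "?g (f x) = x" if "x \<in> verts G" for x
    using that inj by simp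
  have mset: "image_mset f (mset_set (verts G)) = mset_set (verts H)"
    using inj img by (simp add: image_mset_mset_set)
  have "card {\<kappa> \<in> proper_colorings G. coloring_monomial G \<kappa> = m} =
      card {\<kappa> \<in> proper_colorings H. coloring_monomial H \<kappa> = m}" (is "card ?A = card ?B") for m
  proof (rule sym, rule bij_betw_same_card)
    define P where "P \<kappa> = (\<lambda>x\<in>verts G. \<kappa> (f x))" for \<kappa> :: "'b \<Rightarrow> nat"
    define Q where "Q \<kappa> = (\<lambda>x\<in>verts H. \<kappa> (?g x))" for \<kappa> :: "'a \<Rightarrow> nat"
    have fH: "f x \<in> verts H" if "x \<in> verts G" for x using that img by blast
    have mon: "image_mset \<kappa> (mset_set (verts H)) = image_mset \<kappa>' (mset_set (verts G))"
      if "\<And>x. x \<in> verts G \<Longrightarrow> \<kappa>' x = \<kappa> (f x)" for \<kappa> \<kappa>' :: "_ \<Rightarrow> nat"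
    proof -
      have "image_mset \<kappa>' (mset_set (verts G)) = image_mset (\<lambda>x. \<kappa> (f x)) (mset_set (verts G))"
        \<comment> \<open>If \<open>verts G\<close> is infinite, \<open>mset_set\<close> yields the
          empty multiset and the congruence is vacuous.\<close>
        using that by (intro image_mset_cong) (metis elem_mset_set mset_set.infinite empty_iff set_mset_empty)
      then show ?thesis by (simp add: multiset.map_comp comp_def flip: mset)
    qed
    show "bij_betw P ?B ?A"
    proof (rule bij_betw_byWitness[where f' = Q])
      show "\<forall>\<kappa>\<in>?B. Q (P \<kappa>) = \<kappa>"
        using g by (auto simp: P_def Q_def fun_eq_iff proper_colorings_def PiE_iff extensional_def)
      show "\<forall>\<kappa>\<in>?A. P (Q \<kappa>) = \<kappa>"
        using gf fH by (auto simp: P_def Q_def fun_eq_iff proper_colorings_def PiE_iff extensional_def)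
      show "P ` ?B \<subseteq> ?A"
      proof (rule image_subsetI)
        fix \<kappa> assume \<kappa>: "\<kappa> \<in> ?B"
        have "P \<kappa> \<in> proper_colorings G"
        proof (rule proper_coloringsI)
          show "P \<kappa> \<in> verts G \<rightarrow>\<^sub>E {1..}"
            using \<kappa> fH by (auto simp: P_def proper_colorings_def PiE_iff)
          fix u v assume "adjacent G u v"
          then show "P \<kappa> u \<noteq> P \<kappa> v"
            using adj_verts[of u v] adj[of u v] \<kappa> by (auto simp: P_def proper_colorings_def)
        qed
        moreover have "coloring_monomial G (P \<kappa>) = coloring_monomial H \<kappa>"
          unfolding coloring_monomial_def by (rule sym, rule mon) (simp add: P_def)
        ultimately show "P \<kappa> \<in> ?A" using \<kappa> by simp
      qed
      show "Q ` ?A \<subseteq> ?B"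
      proof (rule image_subsetI)
        fix \<kappa> assume \<kappa>: "\<kappa> \<in> ?A"
        have "Q \<kappa> \<in> proper_colorings H"
        proof (rule proper_coloringsI)
          show "Q \<kappa> \<in> verts H \<rightarrow>\<^sub>E {1..}"
            using \<kappa> g by (auto simp: Q_def proper_colorings_def PiE_iff)
          fix x y assume xy: "adjacent H x y"
          then obtain u v where "u \<in> verts G" "v \<in> verts G" "x = f u" "y = f v"
            using adj_H by blast
          then show "Q \<kappa> x \<noteq> Q \<kappa> y"
            using adj[of u v] \<kappa> fH gf xy by (auto simp: Q_def proper_colorings_def)
        qed
        moreover have "coloring_monomial H (Q \<kappa>) = coloring_monomial G \<kappa>"
          unfolding coloring_monomial_def by (rule mon) (simp add: Q_def gf fH)
        ultimately show "Q \<kappa> \<in> ?B" using \<kappa> by simp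
      qed
    qed
  qed
  then show ?thesis by (simp add: mps_eq_iff chromatic_sf.rep_eq)
qed

section \<open>Components of graphs without internal edges\<close>

lemma adjacent_rtranclp_sym: "(adjacent G)\<^sup>*\<^sup>* u v \<Longrightarrow> (adjacent G)\<^sup>*\<^sup>* v u"
  by (metis adjacent_sym sympD sympI symp_rtranclp)

lemma components_closed:
  assumes "simple_graph G" "C \<in> components G" "adjacent G u v" "u \<in> C"
  shows "v \<in> C"
  using assms simple_graph_adjacentD[OF assms(1,3)]
  by (auto simp: components_def intro: rtranclp.rtrancl_into_rtrancl)

text \<open>Reachability is symmetric and transitive, so any member may serve as base vertex.
  Disjointness of components and the choice of a star center rest on this.\<close>

lemma component_eq:
  assumes "C \<in> components G" "x \<in> C"
  shows "C = {w \<in> verts G. (adjacent G)\<^sup>*\<^sup>* x w}"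
proof -
  obtain v where v: "C = {w \<in> verts G. (adjacent G)\<^sup>*\<^sup>* v w}"
    using assms(1) by (auto simp: components_def)
  then have "(adjacent G)\<^sup>*\<^sup>* v x" "(adjacent G)\<^sup>*\<^sup>* x v"
    using assms(2) adjacent_rtranclp_sym by auto
  then have "(adjacent G)\<^sup>*\<^sup>* v w \<longleftrightarrow> (adjacent G)\<^sup>*\<^sup>* x w" for w
    by (meson rtranclp_trans)
  with v show ?thesis by simp
qed

lemma components_disjoint: "pairwise disjnt (components G)"
proof (rule pairwiseI)
  fix C D assume CD: "C \<in> components G" "D \<in> components G" "C \<noteq> D"
  have "C = D" if "x \<in> C" "x \<in> D" for x
    by (rule trans[OF component_eq[OF CD(1) that(1)] component_eq[OF CD(2) that(2), symmetric]])
  then show "disjnt C D" using CD(3) by (auto simp: disjnt_iff)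
qed

lemma component_subset: "C \<in> components G \<Longrightarrow> C \<subseteq> verts G"
  by (auto simp: components_def)

lemma component_nonempty: "C \<in> components G \<Longrightarrow> C \<noteq> {}"
  by (auto simp: components_def)

lemma Union_components: "\<Union>(components G) = verts G"
  by (auto simp: components_def)

lemma finite_components: "finite (verts G) \<Longrightarrow> finite (components G)"
  by (rule finite_subset[of _ "Pow (verts G)"]) (auto dest: component_subset)

lemma singleton_component_iff:
  assumes "simple_graph G" "v \<in> verts G"
  shows "{v} \<in> components G \<longleftrightarrow> (\<forall>w. \<not> adjacent G v w)"
proof
  assume C: "{v} \<in> components G"
  show "\<forall>w. \<not> adjacent G v w"
  proof (intro allI notI)
    fix w assume "adjacent G v w"
    then show False
      using components_closed[OF assms(1) C] simple_graph_adjacentD[OF assms(1)] by blast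
  qed
next
  assume "\<forall>w. \<not> adjacent G v w"
  then have "{w \<in> verts G. (adjacent G)\<^sup>*\<^sup>* v w} = {v}"
    using assms(2) by (auto elim: converse_rtranclpE)
  then show "{v} \<in> components G" using assms(2) unfolding components_def by blast
qed

text \<open>Isolated vertices are the singleton components, that is the parts equal to 1. Hence the
  sign of a term depends only on its partition.\<close>

lemma isolated_count_eq_count_component_partition:
  assumes "simple_graph G"
  shows "isolated_count G = count (component_partition G) 1"
proof -
  have fin: "finite (components G)" using assms by (simp add: finite_components simple_graph_finite)
  have "{C \<in> components G. card C = 1} = (\<lambda>v. {v}) ` {v \<in> verts G. \<forall>w. \<not> adjacent G v w}"
    using singleton_component_iff[OF assms] component_subset
    by (fastforce simp: card_1_singleton_iff)
  then have "card {C \<in> components G. card C = 1} = isolated_count G"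
    by (simp add: isolated_count_simple[OF assms] card_image)
  moreover have "count (component_partition G) 1 = card {C \<in> components G. card C = 1}"
    unfolding card_eq_sum component_partition_def count_image_mset'
    using fin by (intro sum.cong) auto
  ultimately show ?thesis by simp
qed

text \<open>Every edge has an end with no other neighbour. A center is therefore found at an
  arbitrary vertex \<open>v\<close> of the component or at a neighbour of \<open>v\<close>.\<close>

lemma star_component:
  assumes "simple_graph G" and no_internal: "\<nexists>e. internal_edge G e" and C: "C \<in> components G"
  shows "\<exists>c\<in>C. \<forall>u\<in>C. \<forall>v\<in>C. adjacent G u v \<longleftrightarrow> u \<noteq> v \<and> (u = c \<or> v = c)"
proof -
  note sym = adjacent_sym[of G, THEN iffD1]
  have leaf: "(\<forall>a b. adjacent G u a \<longrightarrow> adjacent G u b \<longrightarrow> a = b) \<or>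
      (\<forall>a b. adjacent G v a \<longrightarrow> adjacent G v b \<longrightarrow> a = b)" if "adjacent G u v" for u v
  proof -
    have "\<not> internal_edge G {u, v}" using no_internal by blast
    moreover have "card {u, v} = 2" using simple_graph_adjacentD[OF assms(1) that] by simp
    ultimately have "\<not> vertex_degree G u > 1 \<or> \<not> vertex_degree G v > 1"
      using that by (auto simp: internal_edge_def adjacent_def)
    then show ?thesis unfolding vertex_degree_gt_1_iff[OF assms(1)] by blast
  qed
  obtain v where v: "v \<in> C" using component_nonempty[OF C] by blast
  have "\<exists>c\<in>C. \<forall>x y. adjacent G c x \<longrightarrow> adjacent G x y \<longrightarrow> y = c"
  proof (cases "\<forall>x y. adjacent G v x \<longrightarrow> adjacent G x y \<longrightarrow> y = v")
    case True
    with v show ?thesis by blast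
  next
    case False
    then obtain w z where w: "adjacent G v w" "adjacent G w z" "z \<noteq> v" by blast
    then have "w \<in> C" using components_closed[OF assms(1) C] v by blast
    \<comment> \<open>The vertex \<open>w\<close> has the two neighbours \<open>v\<close> and
      \<open>z\<close>, so on each edge from \<open>w\<close> it is the other end that has no
      further neighbour.\<close>
    moreover have "y = w" if "adjacent G w x" "adjacent G x y" for x y
      using leaf[OF that(1)] w that sym by metis
    ultimately show ?thesis by blast
  qed
  then obtain c where c: "c \<in> C" and nb: "\<And>x y. adjacent G c x \<Longrightarrow> adjacent G x y \<Longrightarrow> y = c"
    by blast
  \<comment> \<open>A walk from \<open>c\<close> alternates between \<open>c\<close> and its
    neighbours, since every second step returns to \<open>c\<close>.\<close>
  have reach: "x = c \<or> adjacent G c x" if "(adjacent G)\<^sup>*\<^sup>* c x" for x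
    using that by induction (auto dest: nb)
  then have C_sub: "x = c \<or> adjacent G c x" if "x \<in> C" for x
    using that component_eq[OF C c] by blast
  have "adjacent G u v \<longleftrightarrow> u \<noteq> v \<and> (u = c \<or> v = c)" if "u \<in> C" "v \<in> C" for u v
    using C_sub[OF that(1)] C_sub[OF that(2)] nb sym simple_graph_adjacentD(3)[OF assms(1)] by metis
  with c show ?thesis by blast
qed

lemma graph_iso_star_graph:
  assumes "simple_graph G" "finite C" and c: "c \<in> C"
    and adj: "\<And>u v. u \<in> C \<Longrightarrow> v \<in> C \<Longrightarrow> adjacent G u v \<longleftrightarrow> u \<noteq> v \<and> (u = c \<or> v = c)"
  shows "graph_iso (induced_subgraph G C) (star_graph (card C))"
proof -
  let ?E = "(\<lambda>x. {c, x}) ` (C - {c})"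
  have "{e \<in> set_mset (edges G). e \<subseteq> C} = ?E"
  proof (intro equalityI subsetI)
    fix e assume e: "e \<in> {e \<in> set_mset (edges G). e \<subseteq> C}"
    then obtain a b where ab: "e = {a, b}" "adjacent G a b"
      by (auto elim: simple_graph_edgeE[OF assms(1)])
    then have "a \<noteq> b \<and> (a = c \<or> b = c)" using adj[of a b] e by auto
    then show "e \<in> ?E" using ab e by (auto simp: insert_commute)
  next
    fix e assume "e \<in> ?E"
    then obtain x where "x \<in> C" "x \<noteq> c" "e = {c, x}" by blast
    then show "e \<in> {e \<in> set_mset (edges G). e \<subseteq> C}"
      using adj[of c x] c by (auto simp: adjacent_def)
  qed
  then have edges: "edges (induced_subgraph G C) = mset_set ?E"
    unfolding induced_subgraph_def mgraph.sel
    by (subst simple_graph_edges_eq[OF assms(1)]) simp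
  have "card C > 0" using assms(2) c card_gt_0_iff by blast
  then have "card (C - {c}) = card {1..<card C}" using assms(2) c by simp
  then obtain h where h: "bij_betw h (C - {c}) {1..<card C}"
    using assms(2) finite_same_card_bij[of "C - {c}" "{1..<card C}"] by auto
  \<comment> \<open>The center goes to 0, the center of \<open>star_graph\<close>, and the leaves
    are numbered from 1.\<close>
  define f where "f = h(c := 0)"
  have fh: "f ` (C - {c}) = {1..<card C}" "inj_on f (C - {c})"
    using h by (auto simp: f_def bij_betw_def inj_on_def)
  have fc: "f c = 0" by (simp add: f_def)
  have inj: "inj_on f C"
  proof -
    have "inj_on f (insert c (C - {c}))" using fh fc by (subst inj_on_insert) auto
    then show ?thesis using c by (simp add: insert_absorb)
  qed
  have "f ` C = insert (f c) (f ` (C - {c}))" using c by blast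
  also have "\<dots> = {..<card C}" using fh fc \<open>card C > 0\<close> by auto
  finally have "bij_betw f C {..<card C}" using inj by (simp add: bij_betw_def)
  moreover have "image_mset (image f) (mset_set ?E) = mset_set ((\<lambda>i. {0, i}) ` {1..<card C})"
  proof -
    \<comment> \<open>Distinct edges keep distinct images, so the image multiset again has all
      multiplicities 1.\<close>
    have "inj_on (image f) ?E"
      by (rule inj_on_subset[OF inj_on_image_Pow[OF inj]]) (use c in auto)
    then have "image_mset (image f) (mset_set ?E) = mset_set (image f ` ?E)"
      by (rule image_mset_mset_set)
    also have "image f ` ?E = (\<lambda>i. {0, i}) ` f ` (C - {c})"
      by (simp add: image_image fc)
    finally show ?thesis by (simp add: fh)
  qed
  ultimately show ?thesis
    unfolding graph_iso_def edges by (auto simp: star_graph_def)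
qed

text \<open>Each component is a star by \<open>star_component\<close>. No edge leaves a component,
  so \<open>X\<close> is the product over the components.\<close>

lemma star_decomposition:
  assumes "simple_graph G" "\<nexists>e. internal_edge G e"
  shows "disjoint_union_of_stars G"
    and "chromatic_sf G = star_sf_partition (component_partition G)"
proof -
  have fin_C: "finite C" if "C \<in> components G" for C
    using that component_subset simple_graph_finite[OF assms(1)] finite_subset by blast
  have iso: "graph_iso (induced_subgraph G C) (star_graph (card C))" if C: "C \<in> components G" for C
    using star_component[OF assms C] graph_iso_star_graph[OF assms(1) fin_C[OF C]] by blast
  have "card C \<ge> 1" if "C \<in> components G" for C
    using component_nonempty[OF that] fin_C[OF that] by (simp add: Suc_le_eq card_gt_0_iff)
  then show "disjoint_union_of_stars G"
    using iso unfolding disjoint_union_of_stars_def by blast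
  have "chromatic_sf G = chromatic_sf (induced_subgraph G (\<Union>(components G)))"
    by (simp add: Union_components induced_subgraph_verts[OF assms(1)])
  also have "\<dots> = (\<Prod>C\<in>components G. chromatic_sf (induced_subgraph G C))"
    using finite_components[OF simple_graph_finite[OF assms(1)]] fin_C components_disjoint
      components_closed[OF assms(1)]
    by (intro chromatic_sf_disjoint_Union)
  also have "\<dots> = (\<Prod>C\<in>components G. star_sf (card C))"
    using iso by (intro prod.cong) (auto simp: star_sf_def induced_subgraph_def intro!: chromatic_sf_iso)
  also have "\<dots> = star_sf_partition (component_partition G)"
    by (simp add: star_sf_partition_def component_partition_def prod_unfold_prod_mset
        multiset.map_comp comp_def)
  finally show "chromatic_sf G = star_sf_partition (component_partition G)" .
qed

section \<open>The star expansion and the common sign of equal terms\<close>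

theorem theorem3p4:
  fixes G :: "'a mgraph" and T :: "'a mgraph signed_tree"
  assumes "simple_graph G"
    and "star_expansion_output G T"
  shows "(\<forall>H\<in>#leaf_labels T. disjoint_union_of_stars H) \<and>
    chromatic_sf G =
      (\<Sum>H\<in>#leaf_labels T.
        mps_const (expansion_sign G H) * star_sf_partition (component_partition H)) \<and>
    (\<forall>\<mu>. 0 \<notin># \<mu> \<longrightarrow>
      (\<forall>H\<in>#leaf_labels T. \<forall>H'\<in>#leaf_labels T.
        component_partition H = \<mu> \<and> component_partition H' = \<mu> \<longrightarrow>
        expansion_sign G H = expansion_sign G H'))"
proof -
  have steps: "expansion_step\<^sup>*\<^sup>* (Node G []) T"
    and no_internal: "\<And>H. H \<in># leaf_labels T \<Longrightarrow> \<nexists>e. internal_edge H e"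
    using assms(2) by (auto simp: star_expansion_output_def)
  note inv = expansion_steps_invariant[OF steps assms(1)]
  then have simple: "simple_graph H" if "H \<in># leaf_labels T" for H
    using that by blast
  note stars = star_decomposition[OF simple no_internal]
  have "chromatic_sf G = leaf_sum G (leaf_labels T)" using inv by simp
  \<comment> \<open>Only at termination are all leaves free of internal edges, so that each
    \<open>chromatic_sf H\<close> can be replaced by a star product.\<close>
  also have "\<dots> = (\<Sum>H\<in>#leaf_labels T.
      mps_const (expansion_sign G H) * star_sf_partition (component_partition H))"
    unfolding leaf_sum_def using stars(2) by (intro arg_cong[of _ _ sum_mset] image_mset_cong) simp
  finally have expansion: "chromatic_sf G = (\<Sum>H\<in>#leaf_labels T.
      mps_const (expansion_sign G H) * star_sf_partition (component_partition H))" .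
  \<comment> \<open>Equal partitions have equally many parts 1, hence the isolated counts
    agree.\<close>
  have "expansion_sign G H = expansion_sign G H'"
    if "H \<in># leaf_labels T" "H' \<in># leaf_labels T" "component_partition H = component_partition H'"
    for H H'
    using that simple
    by (intro expansion_sign_cong) (simp add: isolated_count_eq_count_component_partition)
  with stars(1) expansion show ?thesis by metis
qed

end
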